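(* Let $k\ge 0$ be an even integer and let $u:\mathbb{R}\to\mathbb{R}$ be a smooth function. For each mesh size $\Delta x>0$, let $x_i=i\Delta x$ ($i\in\mathbb{Z}$) and suppose we are given a piecewise polynomial $R(x)=\sum_i R_i(x)\chi_i(x)$, where $$R_i(x)=\sum_{\ell=0}^k\frac{R_i^{(\ell)}}{\ell!}(x-x_i)^\ell$$ is a polynomial of degree at most $k$ with real coefficients $R_i^{(\ell)}$, and $\chi_i$ is the characteristic function of the cell $I_i=[x_i-\Delta x/2,\,x_i+\Delta x/2]$. Suppose that $$u^{(\ell)}(x_i)=R_i^{(\ell)}+\mathcal{O}\big(\Delta x^{k+2-\ell}\big)\quad\text{for every even integer }\ell\text{ with }0\le\ell\le k,$$ $$u^{(\ell)}(x_i)-u^{(\ell)}(x_{i+1})=R_i^{(\ell)}-R_{i+1}^{(\ell)}+\mathcal{O}\big(\Delta x^{k+2-\ell}\big)\quad\text{for every odd integer }\ell\text{ with }0\le\ell<k.$$ Then for any $\theta\in[0,1)$ the reconstruction $Q_{i+\theta}$ is a $(k+2)$-th order approximation of the sliding average of $u$ at $x_{i+\theta}=x_i+\theta\Delta x$: $$Q_{i+\theta}=\bar u(x_{i+\theta})+\mathcal{O}\big(\Delta x^{k+2}\big).$$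
   Context: The sliding average of $u$ (with mesh size $\Delta x$) is $\bar u(x)=\frac1{\Delta x}\int_{x-\Delta x/2}^{x+\Delta x/2}u(y)\,dy$. Here $u^{(\ell)}$ is the $\ell$-th derivative of $u$, whereas $R_i^{(\ell)}$ denotes the given coefficients of $R_i$ (equivalently the $\ell$-th derivative of $R_i$ at $x_i$). For $\theta\in[0,1)$ the reconstruction is the sliding average of $R$ at $x_{i+\theta}$, with $x_{i\pm\frac12}=x_i\pm\Delta x/2$ and $x_{i\pm\frac12+\theta}=x_{i\pm\frac12}+\theta\Delta x$: $$Q_{i+\theta}=\frac1{\Delta x}\int_{x_{i-\frac12+\theta}}^{x_{i+\frac12+\theta}}R(x)\,dx=\frac1{\Delta x}\int_{x_{i-\frac12+\theta}}^{x_{i+\frac12}}R_i(x)\,dx+\frac1{\Delta x}\int_{x_{i+\frac12}}^{x_{i+\frac12+\theta}}R_{i+1}(x)\,dx .$$ Equivalently, $Q_{i+\theta}=\sum_{\ell=0}^k(\Delta x)^\ell\big(\alpha_\ell(\theta)R_i^{(\ell)}+\beta_\ell(\theta)R_{i+1}^{(\ell)}\big)$ with $\alpha_\ell(\theta)=\frac{1-(2\theta-1)^{\ell+1}}{2^{\ell+1}(\ell+1)!}$ and $\beta_\ell(\theta)=\frac{(2\theta-1)^{\ell+1}-(-1)^{\ell+1}}{2^{\ell+1}(\ell+1)!}$. The $\mathcal{O}$ symbols refer to $\Delta x\to0$, with implied constants uniform over the indices $i$ for which $x_i$ lies in any fixed bounded set. *)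

theory Defs
  imports "HOL-Analysis.Analysis"
begin

definition smooth :: "(real \<Rightarrow> real) \<Rightarrow> bool" where
  "smooth u \<longleftrightarrow> (\<forall>n x. (deriv ^^ n) u differentiable at x)"

definition grid_point :: "real \<Rightarrow> int \<Rightarrow> real" where
  "grid_point h i = of_int i * h"

definition cell :: "real \<Rightarrow> int \<Rightarrow> real set" where
  "cell h i = {grid_point h i - h / 2 .. grid_point h i + h / 2}"

definition sliding_average :: "real \<Rightarrow> (real \<Rightarrow> real) \<Rightarrow> real \<Rightarrow> real" where
  "sliding_average h f x = 1 / h * integral {x - h / 2 .. x + h / 2} f"

text \<open>
  For one mesh size \<open>h\<close>, the argument \<open>r i l\<close> is the coefficient $R_i^{(l)}$.
\<close>

definition cell_poly :: "nat \<Rightarrow> real \<Rightarrow> (int \<Rightarrow> nat \<Rightarrow> real) \<Rightarrow> int \<Rightarrow> real \<Rightarrow> real" where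
  "cell_poly k h r i x = (\<Sum>l=0..k. r i l / fact l * (x - grid_point h i) ^ l)"

text \<open>
  The cells are closed, so at an interface the two adjacent polynomials are added. This happens on
  a null set and does not affect integrals. For \<open>h > 0\<close> at most two terms of the sum are nonzero.
\<close>

definition piecewise_poly :: "nat \<Rightarrow> real \<Rightarrow> (int \<Rightarrow> nat \<Rightarrow> real) \<Rightarrow> real \<Rightarrow> real" where
  "piecewise_poly k h r x = (\<Sum>\<^sub>\<infinity>i. cell_poly k h r i x * indicator (cell h i) x)"

definition reconstruction :: "nat \<Rightarrow> real \<Rightarrow> (int \<Rightarrow> nat \<Rightarrow> real) \<Rightarrow> int \<Rightarrow> real \<Rightarrow> real" where
  "reconstruction k h r i \<theta> =
     sliding_average h (piecewise_poly k h r) (grid_point h i + \<theta> * h)"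

text \<open>
  \<open>grid_bigo E p\<close> says that $E(h, i) = O(h^p)$ as \<open>h\<close> tends to 0 from above, where both the implied
  constant and the range of admissible \<open>h\<close> are uniform over the indices \<open>i\<close> whose grid point lies
  in a given bounded set.
\<close>

definition grid_bigo :: "(real \<Rightarrow> int \<Rightarrow> real) \<Rightarrow> nat \<Rightarrow> bool" where
  "grid_bigo E p \<longleftrightarrow> (\<forall>S. bounded S \<longrightarrow>
     (\<exists>C. \<forall>\<^sub>F h in at_right 0. \<forall>i. grid_point h i \<in> S \<longrightarrow> \<bar>E h i\<bar> \<le> C * h ^ p))"

end

theory Submission
  imports Defs
begin

text \<open>
  The reconstruction is linear in the coefficients. For even degrees each coefficient error is small
  enough by itself. For odd degrees the weights of the two cells are opposite, so only the difference
  of the errors in neighbouring cells enters. The remaining consistency error is that of a Taylor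
  polynomial, and \<open>k + 1\<close> being odd gives the extra order.
\<close>

subsection \<open>Calculus of \<open>grid_bigo\<close>\<close>

text \<open>Every bounded set lies in a symmetric interval, so these intervals suffice; passing to a
  neighbouring cell then only enlarges the radius.\<close>

lemma grid_bigoI:
  assumes "\<And>B. \<exists>C. \<forall>\<^sub>F h in at_right 0. \<forall>i. \<bar>grid_point h i\<bar> \<le> B \<longrightarrow> \<bar>E h i\<bar> \<le> C * h ^ p"
  shows "grid_bigo E p"
  unfolding grid_bigo_def
proof (intro allI impI)
  fix S :: "real set" assume "bounded S"
  then obtain B where B: "\<And>x. x \<in> S \<Longrightarrow> \<bar>x\<bar> \<le> B"
    by (auto simp: bounded_iff)
  obtain C where C: "\<forall>\<^sub>F h in at_right 0. \<forall>i. \<bar>grid_point h i\<bar> \<le> B \<longrightarrow> \<bar>E h i\<bar> \<le> C * h ^ p"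
    using assms by blast
  show "\<exists>C. \<forall>\<^sub>F h in at_right 0. \<forall>i. grid_point h i \<in> S \<longrightarrow> \<bar>E h i\<bar> \<le> C * h ^ p"
  proof (intro exI)
    show "\<forall>\<^sub>F h in at_right 0. \<forall>i. grid_point h i \<in> S \<longrightarrow> \<bar>E h i\<bar> \<le> C * h ^ p"
      using C by eventually_elim (use B in blast)
  qed
qed

lemma grid_bigoD:
  assumes "grid_bigo E p"
  shows "\<exists>C. \<forall>\<^sub>F h in at_right 0. \<forall>i. \<bar>grid_point h i\<bar> \<le> B \<longrightarrow> \<bar>E h i\<bar> \<le> C * h ^ p"
proof -
  have "bounded {-B..B}" by simp
  then have "\<exists>C. \<forall>\<^sub>F h in at_right 0. \<forall>i. grid_point h i \<in> {-B..B} \<longrightarrow> \<bar>E h i\<bar> \<le> C * h ^ p"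
    using assms unfolding grid_bigo_def by blast
  then show ?thesis by (simp add: abs_le_iff minus_le_iff conj_commute)
qed

lemma eventually_at_right_0: "\<forall>\<^sub>F h in at_right (0::real). 0 < h \<and> h < 1"
  by (rule eventually_at_rightI[of 0 1]) auto

text \<open>The filter \<open>at_right 0\<close> only sees positive mesh sizes, and the closed form
  of the reconstruction is available only for them.\<close>

lemma grid_bigo_cong:
  assumes "grid_bigo E p" and "\<And>h i. 0 < h \<Longrightarrow> E h i = F h i"
  shows "grid_bigo F p"
proof (rule grid_bigoI)
  fix B
  obtain C where C: "\<forall>\<^sub>F h in at_right 0. \<forall>i. \<bar>grid_point h i\<bar> \<le> B \<longrightarrow> \<bar>E h i\<bar> \<le> C * h ^ p"
    using grid_bigoD[OF assms(1)] by blast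
  have "\<forall>\<^sub>F h in at_right 0. \<forall>i. \<bar>grid_point h i\<bar> \<le> B \<longrightarrow> \<bar>F h i\<bar> \<le> C * h ^ p"
    using C eventually_at_right_0 by eventually_elim (simp add: assms(2)[symmetric])
  then show "\<exists>C. \<forall>\<^sub>F h in at_right 0. \<forall>i. \<bar>grid_point h i\<bar> \<le> B \<longrightarrow> \<bar>F h i\<bar> \<le> C * h ^ p" ..
qed

lemma grid_bigo_zero: "grid_bigo (\<lambda>h i. 0) p"
  by (rule grid_bigoI) (intro exI[of _ 0], simp)

lemma grid_bigo_add:
  assumes "grid_bigo E p" "grid_bigo F p"
  shows "grid_bigo (\<lambda>h i. E h i + F h i) p"
proof (rule grid_bigoI)
  fix B
  obtain C where C: "\<forall>\<^sub>F h in at_right 0. \<forall>i. \<bar>grid_point h i\<bar> \<le> B \<longrightarrow> \<bar>E h i\<bar> \<le> C * h ^ p"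
    using grid_bigoD[OF assms(1)] by blast
  obtain D where D: "\<forall>\<^sub>F h in at_right 0. \<forall>i. \<bar>grid_point h i\<bar> \<le> B \<longrightarrow> \<bar>F h i\<bar> \<le> D * h ^ p"
    using grid_bigoD[OF assms(2)] by blast
  have "\<forall>\<^sub>F h in at_right 0. \<forall>i. \<bar>grid_point h i\<bar> \<le> B \<longrightarrow> \<bar>E h i + F h i\<bar> \<le> (C + D) * h ^ p"
    using C D by eventually_elim (force simp: distrib_right intro: order_trans[OF abs_triangle_ineq])
  then show "\<exists>C. \<forall>\<^sub>F h in at_right 0. \<forall>i. \<bar>grid_point h i\<bar> \<le> B \<longrightarrow> \<bar>E h i + F h i\<bar> \<le> C * h ^ p" ..
qed

lemma grid_bigo_sum:
  assumes "\<And>l. l \<in> A \<Longrightarrow> grid_bigo (E l) p"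
  shows "grid_bigo (\<lambda>h i. \<Sum>l\<in>A. E l h i) p"
  using assms
  by (induction A rule: infinite_finite_induct) (simp_all add: grid_bigo_zero grid_bigo_add)

text \<open>Used with \<open>q = 0\<close> for constant weights and with \<open>c = 1\<close> for
  pure powers of \<open>h\<close>.\<close>

lemma grid_bigo_cmult_power:
  assumes "grid_bigo E p"
  shows "grid_bigo (\<lambda>h i. c * h ^ q * E h i) (q + p)"
proof (rule grid_bigoI)
  fix B
  obtain C where C: "\<forall>\<^sub>F h in at_right 0. \<forall>i. \<bar>grid_point h i\<bar> \<le> B \<longrightarrow> \<bar>E h i\<bar> \<le> C * h ^ p"
    using grid_bigoD[OF assms] by blast
  have "\<forall>\<^sub>F h in at_right 0. \<forall>i. \<bar>grid_point h i\<bar> \<le> B \<longrightarrow>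
          \<bar>c * h ^ q * E h i\<bar> \<le> (\<bar>c\<bar> * C) * h ^ (q + p)"
    using C eventually_at_right_0
  proof eventually_elim
    case (elim h)
    have "\<bar>c * h ^ q * E h i\<bar> \<le> (\<bar>c\<bar> * C) * h ^ (q + p)" if "\<bar>grid_point h i\<bar> \<le> B" for i
    proof -
      have "\<bar>c * h ^ q * E h i\<bar> = \<bar>c\<bar> * h ^ q * \<bar>E h i\<bar>"
        using elim by (simp add: abs_mult)
      also have "\<dots> \<le> \<bar>c\<bar> * h ^ q * (C * h ^ p)"
        using elim that by (intro mult_left_mono) auto
      finally show ?thesis by (simp add: power_add mult_ac)
    qed
    then show ?case by blast
  qed
  then show "\<exists>C. \<forall>\<^sub>F h in at_right 0. \<forall>i. \<bar>grid_point h i\<bar> \<le> B \<longrightarrow>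
               \<bar>c * h ^ q * E h i\<bar> \<le> C * h ^ (q + p)" ..
qed

lemma grid_bigo_minus: "grid_bigo E p \<Longrightarrow> grid_bigo (\<lambda>h i. - E h i) p"
  by (simp add: grid_bigo_def)

lemma grid_point_Suc: "grid_point h (i + 1) = grid_point h i + h"
  by (simp add: grid_point_def algebra_simps)

text \<open>For \<open>h < 1\<close> the next grid point is less than 1 away, so the bound on the
  interval of radius \<open>B + 1\<close> applies to it.\<close>

lemma grid_bigo_shift:
  assumes "grid_bigo E p"
  shows "grid_bigo (\<lambda>h i. E h (i + 1)) p"
proof (rule grid_bigoI)
  fix B
  obtain C where C: "\<forall>\<^sub>F h in at_right 0. \<forall>i. \<bar>grid_point h i\<bar> \<le> B + 1 \<longrightarrow> \<bar>E h i\<bar> \<le> C * h ^ p"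
    using grid_bigoD[OF assms] by blast
  have "\<forall>\<^sub>F h in at_right 0. \<forall>i. \<bar>grid_point h i\<bar> \<le> B \<longrightarrow> \<bar>E h (i + 1)\<bar> \<le> C * h ^ p"
    using C eventually_at_right_0
  proof eventually_elim
    case (elim h)
    have "\<bar>grid_point h (i + 1)\<bar> \<le> B + 1" if "\<bar>grid_point h i\<bar> \<le> B" for i
      using elim that unfolding grid_point_Suc by linarith
    with elim show ?case by blast
  qed
  then show "\<exists>C. \<forall>\<^sub>F h in at_right 0. \<forall>i. \<bar>grid_point h i\<bar> \<le> B \<longrightarrow> \<bar>E h (i + 1)\<bar> \<le> C * h ^ p" ..
qed

subsection \<open>Taylor expansion\<close>

lemma smooth_deriv_iterate:
  assumes "smooth u"
  shows "smooth ((deriv ^^ m) u)"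
proof -
  have "(deriv ^^ n) ((deriv ^^ m) u) = (deriv ^^ (n + m)) u" for n
    by (simp add: funpow_add)
  with assms show ?thesis by (simp add: smooth_def)
qed

lemma smooth_DERIV:
  "smooth u \<Longrightarrow> ((deriv ^^ n) u has_real_derivative (deriv ^^ Suc n) u x) (at x)"
  unfolding smooth_def
  by (simp add: DERIV_deriv_iff_real_differentiable)

text \<open>Lagrange remainder, with \<open>M\<close> bounding the \<open>n\<close>-th derivative on
  a compact interval; this makes \<open>M\<close> uniform in both the point and the centre.\<close>

lemma smooth_Taylor_bound:
  assumes "smooth u" "0 < n"
  shows "\<exists>M\<ge>0. \<forall>x c. \<bar>x\<bar> \<le> B \<longrightarrow> \<bar>c\<bar> \<le> B \<longrightarrow>
           \<bar>u x - (\<Sum>l<n. (deriv ^^ l) u c / fact l * (x - c) ^ l)\<bar> \<le> M * \<bar>x - c\<bar> ^ n"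
proof -
  have "continuous_on {-B..B} ((deriv ^^ n) u)"
    using smooth_DERIV[OF assms(1)] by (blast intro: continuous_at_imp_continuous_on DERIV_isCont)
  then have "bounded ((deriv ^^ n) u ` {-B..B})"
    using compact_continuous_image compact_imp_bounded compact_Icc by blast
  then obtain M where "0 < M" and M: "\<forall>t\<in>{-B..B}. \<bar>(deriv ^^ n) u t\<bar> \<le> M"
    by (auto simp: bounded_pos)
  have "\<bar>u x - (\<Sum>l<n. (deriv ^^ l) u c / fact l * (x - c) ^ l)\<bar> \<le> M * \<bar>x - c\<bar> ^ n"
    if xc: "\<bar>x\<bar> \<le> B" "\<bar>c\<bar> \<le> B" for x c
  \<comment> \<open>The Lagrange form needs distinct points. If they coincide, only the term of
    degree 0 survives and both sides vanish, as \<open>0 < n\<close>.\<close>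
  proof (cases "x = c")
    case True
    have "(\<Sum>l<n. (deriv ^^ l) u c / fact l * (x - c) ^ l) = (\<Sum>l<n. if l = 0 then u c else 0)"
      using True by (intro sum.cong) auto
    with True assms(2) show ?thesis by (simp add: zero_power)
  next
    case False
    obtain t where t: "if x < c then x < t \<and> t < c else c < t \<and> t < x"
      and eq: "u x = (\<Sum>l<n. (deriv ^^ l) u c / fact l * (x - c) ^ l)
                 + (deriv ^^ n) u t / fact n * (x - c) ^ n"
      using Taylor[of n "\<lambda>l. (deriv ^^ l) u" u "-B" B c x] assms(2) xc False
        smooth_DERIV[OF assms(1)] by (auto simp: abs_le_iff)
    have "t \<in> {-B..B}" using t xc by (auto split: if_splits)
    then have "\<bar>(deriv ^^ n) u t\<bar> / fact n \<le> M / 1"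
      using M \<open>0 < M\<close> by (intro frac_le) auto
    from mult_right_mono[OF this, of "\<bar>x - c\<bar> ^ n"]
    have "\<bar>(deriv ^^ n) u t / fact n * (x - c) ^ n\<bar> \<le> M * \<bar>x - c\<bar> ^ n"
      by (simp add: abs_mult power_abs)
    with eq show ?thesis by simp
  qed
  with \<open>0 < M\<close> show ?thesis by (intro exI[of _ M]) auto
qed

text \<open>The Taylor bound of order 1 is a local Lipschitz estimate. It will be applied to the
  derivative of order \<open>k + 1\<close>.\<close>

lemma grid_bigo_smooth_diff:
  assumes "smooth u"
  shows "grid_bigo (\<lambda>h i. u (grid_point h i) - u (grid_point h (i + 1))) 1"
proof (rule grid_bigoI)
  fix B
  obtain M where M: "\<And>x c. \<bar>x\<bar> \<le> B + 1 \<Longrightarrow> \<bar>c\<bar> \<le> B + 1 \<Longrightarrow> \<bar>u x - u c\<bar> \<le> M * \<bar>x - c\<bar>"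
    using smooth_Taylor_bound[OF assms, of 1 "B + 1"] by auto
  have "\<forall>\<^sub>F h in at_right 0. \<forall>i. \<bar>grid_point h i\<bar> \<le> B \<longrightarrow>
          \<bar>u (grid_point h i) - u (grid_point h (i + 1))\<bar> \<le> M * h ^ 1"
    using eventually_at_right_0
  proof eventually_elim
    case (elim h)
    show ?case
    proof (intro allI impI)
      fix i assume "\<bar>grid_point h i\<bar> \<le> B"
      with elim have "\<bar>grid_point h i\<bar> \<le> B + 1" "\<bar>grid_point h i + h\<bar> \<le> B + 1"
        by linarith+
      then show "\<bar>u (grid_point h i) - u (grid_point h (i + 1))\<bar> \<le> M * h ^ 1"
        using elim M[of "grid_point h i" "grid_point h i + h"] by (simp add: grid_point_Suc)
    qed
  qed
  then show "\<exists>C. \<forall>\<^sub>F h in at_right 0. \<forall>i. \<bar>grid_point h i\<bar> \<le> B \<longrightarrow>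
               \<bar>u (grid_point h i) - u (grid_point h (i + 1))\<bar> \<le> C * h ^ 1" ..
qed

subsection \<open>The reconstruction in terms of the coefficients\<close>

text \<open>If a second cell contained \<open>x\<close>, the two centres would be less than
  \<open>h\<close> apart, but distinct centres differ by a nonzero integer multiple of
  \<open>h\<close>. So the infinite sum has a single nonzero index at most.\<close>

lemma piecewise_poly_eq:
  assumes "0 < h" and x: "grid_point h i - h / 2 < x" "x < grid_point h i + h / 2"
  shows "piecewise_poly k h r x = cell_poly k h r i x"
proof -
  have "x \<notin> cell h j" if "j \<noteq> i" for j
  proof
    assume "x \<in> cell h j"
    with x have "\<bar>grid_point h i - grid_point h j\<bar> < h"
      by (auto simp: cell_def)
    then have "\<bar>of_int (i - j) :: real\<bar> * h < 1 * h"
      using assms(1) by (simp add: grid_point_def abs_mult flip: left_diff_distrib)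
    then have "\<bar>of_int (i - j) :: real\<bar> < 1"
      using assms(1) by (simp only: mult_less_cancel_right_pos)
    with that show False by linarith
  qed
  then have "piecewise_poly k h r x = (\<Sum>\<^sub>\<infinity>j\<in>{i}. cell_poly k h r j x * indicator (cell h j) x)"
    unfolding piecewise_poly_def by (intro infsum_cong_neutral) auto
  also have "\<dots> = cell_poly k h r i x"
    using x by (simp add: cell_def)
  finally show ?thesis .
qed

lemma has_integral_cell_poly:
  assumes "a \<le> b"
  shows "(cell_poly k h r i has_integral
    (\<Sum>l=0..k. r i l / fact (Suc l) * ((b - grid_point h i) ^ Suc l - (a - grid_point h i) ^ Suc l)))
    {a..b}"
proof -
  let ?F = "\<lambda>x. \<Sum>l=0..k. r i l / fact (Suc l) * (x - grid_point h i) ^ Suc l"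
  have "(?F has_real_derivative cell_poly k h r i x) (at x within {a..b})" for x
    unfolding cell_poly_def
  proof (rule DERIV_sum)
    fix l
    have "((\<lambda>x. c / fact (Suc l) * (x - y) ^ Suc l) has_real_derivative
        c / fact (Suc l) * (real (Suc l) * (x - y) ^ l)) (at x within {a..b})" for c y
      by (auto intro!: derivative_eq_intros simp del: power_Suc fact_Suc)
    then show "((\<lambda>x. r i l / fact (Suc l) * (x - grid_point h i) ^ Suc l) has_real_derivative
        r i l / fact l * (x - grid_point h i) ^ l) (at x within {a..b})"
      by (simp del: power_Suc)
  qed
  then have "(cell_poly k h r i has_integral ?F b - ?F a) {a..b}"
    using assms by (intro fundamental_theorem_of_calculus)
      (auto simp: has_real_derivative_iff_has_vector_derivative)
  then show ?thesis
    by (simp only: right_diff_distrib sum_subtractf)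
qed

text \<open>This is \<alpha>_l(\<theta>), the integral of \<open>s ^ l / fact l\<close> for
  \<open>s\<close> from \<open>\<theta> - 1 / 2\<close> to \<open>1 / 2\<close>, where
  \<open>s\<close> is the offset from the left cell centre in units of \<open>h\<close>.\<close>

definition left_weight :: "real \<Rightarrow> nat \<Rightarrow> real" where
  "left_weight \<theta> l = (1 - (2 * \<theta> - 1) ^ Suc l) / (2 ^ Suc l * fact (Suc l))"

text \<open>This is \<beta>_l(\<theta>), the same integral for \<open>s\<close> from
  \<open>- 1 / 2\<close> to \<open>\<theta> - 1 / 2\<close>, with \<open>s\<close> measured from the
  centre of the right cell.\<close>

definition right_weight :: "real \<Rightarrow> nat \<Rightarrow> real" where
  "right_weight \<theta> l = ((2 * \<theta> - 1) ^ Suc l - (- 1) ^ Suc l) / (2 ^ Suc l * fact (Suc l))"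

text \<open>The two weights add up to the integral of \<open>s ^ l / fact l\<close> over the whole
  symmetric cell, which vanishes for odd \<open>l\<close>.\<close>

lemma right_weight_odd: "odd l \<Longrightarrow> right_weight \<theta> l = - left_weight \<theta> l"
  by (simp add: left_weight_def right_weight_def minus_divide_left del: power_Suc fact_Suc)

text \<open>The window starts in cell \<open>i\<close> and, as \<theta> < 1, ends before the far end
  of cell \<open>i + 1\<close>. Splitting it at the interface leaves one polynomial on each
  piece.\<close>

lemma piecewise_poly_has_integral:
  fixes \<theta> :: real
  defines "weighted \<equiv> \<lambda>k h r i.
    \<Sum>l=0..k. h ^ l * (left_weight \<theta> l * r i l + right_weight \<theta> l * r (i + 1) l)"
  assumes "0 < h" "0 \<le> \<theta>" "\<theta> < 1"
  shows "(piecewise_poly k h r has_integral h * weighted k h r i)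
           {grid_point h i + \<theta> * h - h / 2 .. grid_point h i + \<theta> * h + h / 2}"
proof -
  let ?x = "grid_point h i"
  let ?a = "?x + \<theta> * h - h / 2" and ?m = "?x + h / 2" and ?b = "?x + \<theta> * h + h / 2"
  have \<theta>h: "0 \<le> \<theta> * h" "\<theta> * h < h"
    using assms by (auto simp: mult_less_cancel_right_pos)
  have am: "?a \<le> ?m" "?m \<le> ?b" using \<theta>h by linarith+
  have right: "grid_point h (i + 1) - h / 2 < x" "x < grid_point h (i + 1) + h / 2"
    if "?m \<le> x" "x \<le> ?b" "x \<noteq> ?m" for x
    using that \<theta>h grid_point_Suc[of h i] by linarith+
  \<comment> \<open>The excluded points are the interface \<open>?m\<close> and \<open>?a\<close>,
    which is itself an interface when \<theta> = 0; there two polynomials are added.\<close>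
  have 1: "(piecewise_poly k h r has_integral
      (\<Sum>l=0..k. r i l / fact (Suc l) * ((?m - ?x) ^ Suc l - (?a - ?x) ^ Suc l))) {?a..?m}"
    using \<theta>h
    by (intro has_integral_spike_finite[OF _ _ has_integral_cell_poly[OF am(1)], of "{?a, ?m}"]
          piecewise_poly_eq) (use assms(2) in auto)
  have 2: "(piecewise_poly k h r has_integral
      (\<Sum>l=0..k. r (i + 1) l / fact (Suc l)
         * ((?b - grid_point h (i + 1)) ^ Suc l - (?m - grid_point h (i + 1)) ^ Suc l))) {?m..?b}"
    by (intro has_integral_spike_finite[OF _ _ has_integral_cell_poly[OF am(2)], of "{?m}"]
          piecewise_poly_eq) (use assms(2) right in auto)
  \<comment> \<open>Relative to its own cell centre each endpoint is \<open>h\<close> times a fixed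
    number, so \<open>h ^ Suc l\<close> factors out. The outer endpoints share the factor
    \<open>(2 * \<theta> - 1) / 2\<close> because they are \<open>h\<close> apart, like the
    centres.\<close>
  have pw: "(?m - ?x) = h * (1 / 2)" "?a - ?x = h * ((2 * \<theta> - 1) / 2)"
    "?b - grid_point h (i + 1) = h * ((2 * \<theta> - 1) / 2)"
    "?m - grid_point h (i + 1) = h * ((- 1) / 2)"
    unfolding grid_point_Suc by (simp_all add: field_simps)
  have "(\<Sum>l=0..k. r i l / fact (Suc l) * ((?m - ?x) ^ Suc l - (?a - ?x) ^ Suc l))
      + (\<Sum>l=0..k. r (i + 1) l / fact (Suc l)
         * ((?b - grid_point h (i + 1)) ^ Suc l - (?m - grid_point h (i + 1)) ^ Suc l))
      = h * weighted k h r i"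
    unfolding pw weighted_def sum_distrib_left sum.distrib[symmetric]
  proof (rule sum.cong)
    fix l
    have w: "left_weight \<theta> l = ((1 / 2) ^ Suc l - ((2 * \<theta> - 1) / 2) ^ Suc l) / fact (Suc l)"
      "right_weight \<theta> l = (((2 * \<theta> - 1) / 2) ^ Suc l - ((- 1) / 2) ^ Suc l) / fact (Suc l)"
      unfolding left_weight_def right_weight_def power_divide
      by (simp_all add: diff_divide_distrib del: power_Suc fact_Suc)
    show "r i l / fact (Suc l) * ((h * (1 / 2)) ^ Suc l - (h * ((2 * \<theta> - 1) / 2)) ^ Suc l)
        + r (i + 1) l / fact (Suc l) * ((h * ((2 * \<theta> - 1) / 2)) ^ Suc l - (h * (- 1 / 2)) ^ Suc l)
        = h * (h ^ l * (left_weight \<theta> l * r i l + right_weight \<theta> l * r (i + 1) l))"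
      unfolding w power_mult_distrib[of h] right_diff_distrib[symmetric] power_Suc[of h]
      by (simp add: distrib_left mult_ac del: power_Suc fact_Suc)
  qed simp
  with has_integral_combine[OF am 1 2] show ?thesis by simp
qed

lemma reconstruction_eq:
  assumes "0 < h" "0 \<le> \<theta>" "\<theta> < 1"
  shows "reconstruction k h r i \<theta> =
    (\<Sum>l=0..k. h ^ l * (left_weight \<theta> l * r i l + right_weight \<theta> l * r (i + 1) l))"
  using integral_unique[OF piecewise_poly_has_integral[OF assms]] assms(1)
  by (simp add: reconstruction_def sliding_average_def)

section \<open>Consistency error for exact Taylor coefficients\<close>

text \<open>Off the interfaces the integrand is a Taylor polynomial about a centre at distance at
  most \<open>h\<close>, so it differs from \<open>u\<close> by at most a constant times
  \<open>h ^ Suc n\<close>; averaging preserves this bound.\<close>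

lemma reconstruction_Taylor:
  assumes "smooth u" "0 \<le> \<theta>" "\<theta> < 1"
  shows "grid_bigo (\<lambda>h i. reconstruction n h (\<lambda>i l. (deriv ^^ l) u (grid_point h i)) i \<theta>
           - sliding_average h u (grid_point h i + \<theta> * h)) (Suc n)"
proof (rule grid_bigoI)
  fix B
  let ?r = "\<lambda>h i l. (deriv ^^ l) u (grid_point h i)"
  \<comment> \<open>The radius leaves room for the next grid point, at distance \<open>h\<close>,
    and for the window, which reaches less than \<open>3 * h / 2\<close> from \<open>?x\<close>,
    with \<open>h < 1\<close>.\<close>
  obtain M where "0 \<le> M" and M: "\<And>x c. \<bar>x\<bar> \<le> B + 2 \<Longrightarrow> \<bar>c\<bar> \<le> B + 2 \<Longrightarrow>
      \<bar>u x - (\<Sum>l<Suc n. (deriv ^^ l) u c / fact l * (x - c) ^ l)\<bar> \<le> M * \<bar>x - c\<bar> ^ Suc n"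
    using smooth_Taylor_bound[OF assms(1), of "Suc n" "B + 2"] by auto
  have cell: "\<bar>cell_poly n h (?r h) j x - u x\<bar> \<le> M * h ^ Suc n"
    if "\<bar>x\<bar> \<le> B + 2" "\<bar>grid_point h j\<bar> \<le> B + 2" "\<bar>x - grid_point h j\<bar> \<le> h" for h j x
  proof -
    have "\<bar>cell_poly n h (?r h) j x - u x\<bar> \<le> M * \<bar>x - grid_point h j\<bar> ^ Suc n"
      using M[OF that(1,2)] unfolding cell_poly_def
      by (simp add: atLeast0AtMost lessThan_Suc_atMost abs_minus_commute del: power_Suc sum.lessThan_Suc)
    also have "\<dots> \<le> M * h ^ Suc n"
      using that(3) \<open>0 \<le> M\<close> by (intro mult_left_mono power_mono) auto
    finally show ?thesis .
  qed
  have "\<forall>\<^sub>F h in at_right 0. \<forall>i. \<bar>grid_point h i\<bar> \<le> B \<longrightarrow>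
      \<bar>reconstruction n h (?r h) i \<theta> - sliding_average h u (grid_point h i + \<theta> * h)\<bar> \<le> M * h ^ Suc n"
    using eventually_at_right_0
  proof eventually_elim
    case (elim h)
    show ?case
    proof (intro allI impI)
      fix i assume i: "\<bar>grid_point h i\<bar> \<le> B"
      let ?x = "grid_point h i"
      let ?a = "?x + \<theta> * h - h / 2" and ?m = "?x + h / 2" and ?b = "?x + \<theta> * h + h / 2"
      let ?f = "\<lambda>x. piecewise_poly n h (?r h) x - u x"
      have \<theta>h: "0 \<le> \<theta> * h" "\<theta> * h < h"
        using assms elim by (auto simp: mult_less_cancel_right_pos)
      have "continuous_on {?a..?b} u"
        using smooth_DERIV[OF assms(1), of 0]
        by (auto intro: continuous_at_imp_continuous_on DERIV_isCont)
      then have "u integrable_on {?a..?b}"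
        by (rule integrable_continuous_interval)
      moreover have p: "piecewise_poly n h (?r h) integrable_on {?a..?b}"
        using piecewise_poly_has_integral[of h \<theta>] elim assms by (meson has_integral_integrable)
      ultimately have int: "(?f has_integral
          integral {?a..?b} (piecewise_poly n h (?r h)) - integral {?a..?b} u) (cbox ?a ?b)"
        by (auto intro: has_integral_diff integrable_integral)
      have bd: "\<bar>?f x\<bar> \<le> M * h ^ Suc n" if "x \<in> cbox ?a ?b - {?a, ?m}" for x
      proof (cases "x < ?m")
        case True
        then have "piecewise_poly n h (?r h) x = cell_poly n h (?r h) i x"
          using that \<theta>h elim by (intro piecewise_poly_eq) auto
        then show ?thesis
          using cell[of x h i] that True i \<theta>h elim by (auto simp: abs_le_iff)
      next
        case False
        with that have x: "?m < x" "x \<le> ?b" by auto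
        then have "piecewise_poly n h (?r h) x = cell_poly n h (?r h) (i + 1) x"
          using \<theta>h elim grid_point_Suc[of h i] by (intro piecewise_poly_eq) linarith+
        moreover have "\<bar>x\<bar> \<le> B + 2" "\<bar>grid_point h (i + 1)\<bar> \<le> B + 2"
          "\<bar>x - grid_point h (i + 1)\<bar> \<le> h"
          using x i \<theta>h elim unfolding grid_point_Suc by linarith+
        ultimately show ?thesis
          using cell by simp
      qed
      have "\<bar>integral {?a..?b} (piecewise_poly n h (?r h)) - integral {?a..?b} u\<bar>
          \<le> M * h ^ Suc n * measure lborel (cbox ?a ?b)"
        using has_integral_bound_spike_finite[OF _ _ int, of "M * h ^ Suc n" "{?a, ?m}"]
          bd elim \<open>0 \<le> M\<close> by auto
      also have "\<dots> = M * h ^ Suc n * h"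
        using elim by simp
      \<comment> \<open>The factor \<open>1 / h\<close> of the average cancels the length
        \<open>h\<close> of the window.\<close>
      finally show "\<bar>reconstruction n h (?r h) i \<theta> - sliding_average h u (?x + \<theta> * h)\<bar> \<le> M * h ^ Suc n"
        using elim unfolding reconstruction_def sliding_average_def right_diff_distrib[symmetric]
        by (simp add: abs_mult divide_le_eq del: power_Suc)
    qed
  qed
  then show "\<exists>C. \<forall>\<^sub>F h in at_right 0. \<forall>i. \<bar>grid_point h i\<bar> \<le> B \<longrightarrow>
      \<bar>reconstruction n h (?r h) i \<theta> - sliding_average h u (grid_point h i + \<theta> * h)\<bar> \<le> C * h ^ Suc n" ..
qed

section \<open>Coefficient errors and the final estimate\<close>

theorem proposition2p1:
  fixes k :: nat
    and u :: "real \<Rightarrow> real"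
    and r :: "real \<Rightarrow> int \<Rightarrow> nat \<Rightarrow> real"
    and \<theta> :: real
  assumes "even k"
    and "smooth u"
    and "\<And>l. even l \<Longrightarrow> l \<le> k \<Longrightarrow>
      grid_bigo (\<lambda>h i. (deriv ^^ l) u (grid_point h i) - r h i l) (k + 2 - l)"
    and "\<And>l. odd l \<Longrightarrow> l < k \<Longrightarrow>
      grid_bigo (\<lambda>h i. ((deriv ^^ l) u (grid_point h i) - (deriv ^^ l) u (grid_point h (i + 1)))
                      - (r h i l - r h (i + 1) l)) (k + 2 - l)"
    and "0 \<le> \<theta>" and "\<theta> < 1"
  shows "grid_bigo (\<lambda>h i. reconstruction k h (r h) i \<theta>
                        - sliding_average h u (grid_point h i + \<theta> * h)) (k + 2)"
proof -
  define d where "d h i l = (deriv ^^ l) u (grid_point h i)" for h i l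
  \<comment> \<open>Padding with a zero coefficient of degree \<open>k + 1\<close> lets the Taylor polynomials of that odd
    degree serve as comparison: their top coefficients differ by \<open>O(h)\<close> between neighbouring cells.\<close>
  define r' where "r' h i l = (if l \<le> k then r h i l else 0)" for h i l
  define e where "e h i l = r' h i l - d h i l" for h i l
  let ?t = "\<lambda>l h i. left_weight \<theta> l * e h i l + right_weight \<theta> l * e h (i + 1) l"
  \<comment> \<open>The factor \<open>h ^ l\<close> supplies \<open>l\<close> of the required
    orders, so the weighted errors need only order \<open>k + 2 - l\<close>.\<close>
  have term_bigo: "grid_bigo (\<lambda>h i. h ^ l * ?t l h i) (k + 2)" if l: "l \<le> Suc k" for l
  proof -
    have "grid_bigo (?t l) (k + 2 - l)"
    proof (cases "even l")
      case True
      with l \<open>even k\<close> have lk: "l \<le> k" by (metis even_Suc le_Suc_eq)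
      \<comment> \<open>For even degrees the errors in the two cells are small separately, the
        second by an index shift.\<close>
      have e: "grid_bigo (\<lambda>h i. e h i l) (k + 2 - l)"
        using grid_bigo_minus[OF assms(3)[OF True lk]] lk by (simp add: e_def r'_def d_def)
      show ?thesis
        using grid_bigo_add[OF grid_bigo_cmult_power[OF e, of "left_weight \<theta> l" 0]
            grid_bigo_cmult_power[OF grid_bigo_shift[OF e], of "right_weight \<theta> l" 0]] by simp
    next
      case False
      \<comment> \<open>By \<open>right_weight_odd\<close> the term \<open>?t l\<close> is
        \<open>- left_weight \<theta> l\<close> times this difference.\<close>
      have "grid_bigo (\<lambda>h i. (d h i l - d h (i + 1) l) - (r' h i l - r' h (i + 1) l)) (k + 2 - l)"
      proof (cases "l < k")
        case True
        with assms(4)[OF False] show ?thesis by (simp add: r'_def d_def)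
      next
        case nlt: False
        with l False \<open>even k\<close> have "l = Suc k" by (metis le_Suc_eq linorder_neqE_nat not_le)
        \<comment> \<open>Here \<open>k + 2 - l\<close> is 1, so the Lipschitz estimate is exactly
          what is required.\<close>
        then show ?thesis
          using grid_bigo_smooth_diff[OF smooth_deriv_iterate[OF assms(2), of l]]
          by (simp add: r'_def d_def)
      qed
      from grid_bigo_cmult_power[OF this, of "- left_weight \<theta> l" 0] show ?thesis
        using False by (simp add: right_weight_odd e_def algebra_simps)
    qed
    from grid_bigo_cmult_power[OF this, of 1 l] l show ?thesis by simp
  qed
  \<comment> \<open>Comparison with degree \<open>Suc k\<close> makes the Taylor error of order
    \<open>k + 2\<close>.\<close>
  have "grid_bigo (\<lambda>h i. (\<Sum>l=0..Suc k. h ^ l * ?t l h i)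
      + (reconstruction (Suc k) h (d h) i \<theta> - sliding_average h u (grid_point h i + \<theta> * h))) (k + 2)"
    using reconstruction_Taylor[OF assms(2,5), of "Suc k"] assms(6)
    by (intro grid_bigo_add grid_bigo_sum term_bigo) (simp_all add: d_def[abs_def])
  then show ?thesis
  proof (rule grid_bigo_cong)
    fix h :: real and i assume h: "0 < h"
    have "reconstruction k h (r h) i \<theta> = reconstruction (Suc k) h (r' h) i \<theta>"
      using h assms(5,6) by (simp add: reconstruction_eq r'_def)
    \<comment> \<open>Linearity in the coefficients, with \<open>r'\<close> split as
      \<open>e + d\<close>.\<close>
    also have "\<dots> = (\<Sum>l=0..Suc k. h ^ l * ?t l h i) + reconstruction (Suc k) h (d h) i \<theta>"
      using h assms(5,6)
      by (simp only: reconstruction_eq sum.distrib[symmetric] e_def)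
        (simp add: algebra_simps)
    finally show "(\<Sum>l=0..Suc k. h ^ l * ?t l h i) + (reconstruction (Suc k) h (d h) i \<theta>
        - sliding_average h u (grid_point h i + \<theta> * h))
      = reconstruction k h (r h) i \<theta> - sliding_average h u (grid_point h i + \<theta> * h)" by simp
  qed
qed

end
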